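(* Let $n$ be a positive integer and let $[\alpha_1|\beta_1],[\alpha_2|\beta_2]$ be unbalanced elements of $S\text{-}Block(n)$ with $[\alpha_1|\beta_1]\succeq[\alpha_2|\beta_2]$. If $[\alpha_1|\beta_1]$ is NG-1, then $[\alpha_2|\beta_2]$ is also NG-1. If $[\alpha_1|\beta_1]$ is NG-2, then $[\alpha_2|\beta_2]$ is also NG-2.
   Context: $Dis(n)$ is the set of partitions $\gamma=(g_1,\dots,g_r)$ of $n$ into distinct positive parts $g_1>\dots>g_r>0$, with $\mathrm{len}(\gamma)=r$. For $\gamma=(g_1,\dots,g_r)$ and $\delta=(d_1,\dots,d_s)$ in $Dis(n)$, $\delta\succeq\gamma$ means $\sum_{i=1}^m d_i\ge\sum_{i=1}^m g_i$ for all $m\le\min\{r,s\}$. An $S$-block is an ordered pair $[\alpha|\beta]$ with $\alpha,\beta\in Dis(n)$, $\beta\succeq\alpha$, and $\mathrm{len}(\alpha)\in\{\mathrm{len}(\beta),\mathrm{len}(\beta)+1\}$. $S\text{-}Block(n)$ is the poset of all such $S$-blocks, ordered by $[\alpha_1|\beta_1]\succeq[\alpha_2|\beta_2]$ iff $\alpha_1\succeq\alpha_2$ and $\beta_1\preceq\beta_2$. Graphs are finite and simple, without isolated vertices. For a degree sequence $\pi=(d_1\ge\dots\ge d_r)$, $\alpha(\pi)$ has $i$-th part $d_i-i+1$ for those $i$ with $d_i\ge i$, and $\beta(\pi)$ has $j$-th part $|\{i:d_i\ge j\}|-j$ for those $j$ for which this is positive. A split graph is a graph with a partition $V(G)=K\cup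 S$ with $K$ a clique and $S$ a stable set ($KS$-partition; either part may be empty); it is balanced if some $KS$-partition has simultaneously $|K|$ equal to the size of a largest clique and $|S|$ equal to the size of a largest stable set, and unbalanced otherwise. A graph $G$ is an NG-graph if $\chi(G)+\chi(\overline G)=|V(G)|+1$. With $A_G=\{v:\deg(v)=\chi(G)-1\}$, an NG-graph is NG-1 if $G[A_G]$ is a clique and NG-2 if $G[A_G]$ is a stable set. An $S$-block $[\alpha|\beta]$ is called unbalanced (resp. NG-1, NG-2) if there is an unbalanced split graph (resp. NG-1 graph, NG-2 graph) with degree sequence $\pi$ such that $\alpha=\alpha(\pi)$, $\beta=\beta(\pi)$. (Membership in each of these graph classes is determined by the degree sequence.) *)

theory Defs
  imports "HOL-Library.Multiset" "Graph_Theory.Pair_Digraph"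
begin

section \<open>Partitions into distinct parts and S-blocks\<close>

text \<open>Partitions are written as lists of parts in decreasing order, so that the number of
  parts is the length of the list.\<close>

definition Dis :: "nat \<Rightarrow> nat list set" where
  "Dis n = {\<gamma>. sorted_wrt (>) \<gamma> \<and> (\<forall>g\<in>set \<gamma>. 0 < g) \<and> sum_list \<gamma> = n}"

text \<open>\<open>dominates_part \<delta> \<gamma>\<close> is $\delta \succeq \gamma$: only the partial sums up to the
  smaller of the two lengths are compared.\<close>

definition dominates_part :: "nat list \<Rightarrow> nat list \<Rightarrow> bool" where
  "dominates_part \<delta> \<gamma> \<longleftrightarrow>
     (\<forall>m \<le> min (length \<gamma>) (length \<delta>). sum_list (take m \<delta>) \<ge> sum_list (take m \<gamma>))"

definition S_Block :: "nat \<Rightarrow> (nat list \<times> nat list) set" where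
  "S_Block n = {(\<alpha>, \<beta>). \<alpha> \<in> Dis n \<and> \<beta> \<in> Dis n \<and> dominates_part \<beta> \<alpha> \<and>
     (length \<alpha> = length \<beta> \<or> length \<alpha> = length \<beta> + 1)}"

text \<open>\<open>block_ge B\<^sub>1 B\<^sub>2\<close> is $B_1 \succeq B_2$; the order is reversed in the second component.\<close>

definition block_ge :: "nat list \<times> nat list \<Rightarrow> nat list \<times> nat list \<Rightarrow> bool" where
  "block_ge B\<^sub>1 B\<^sub>2 \<longleftrightarrow>
     dominates_part (fst B\<^sub>1) (fst B\<^sub>2) \<and> dominates_part (snd B\<^sub>2) (snd B\<^sub>1)"


section \<open>The partitions of a degree sequence\<close>

text \<open>Indices \<open>i\<close> and \<open>j\<close> start at 1, while list positions start at 0.\<close>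

definition alpha_of :: "nat list \<Rightarrow> nat list" where
  "alpha_of d = map (\<lambda>i. d ! (i - 1) + 1 - i)
     (filter (\<lambda>i. d ! (i - 1) \<ge> i) [1..<length d + 1])"

text \<open>The number of \<open>i\<close> with \<open>d\<^sub>i \<ge> j\<close> is at most \<open>length d\<close>, so that no positive part has
  index \<open>j > length d\<close>.\<close>

definition beta_of :: "nat list \<Rightarrow> nat list" where
  "beta_of d = map (\<lambda>j. card {i\<in>{1..length d}. d ! (i - 1) \<ge> j} - j)
     (filter (\<lambda>j. card {i\<in>{1..length d}. d ! (i - 1) \<ge> j} > j) [1..<length d + 1])"


section \<open>Graphs\<close>

text \<open>The locale predicate \<open>pair_graph\<close> describes finite simple graphs: both \<open>(u, v)\<close> and
  \<open>(v, u)\<close> are arcs when \<open>u\<close> and \<open>v\<close> are adjacent, and the out-degree is the degree.\<close>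

definition simple_graph :: "'a pair_pre_digraph \<Rightarrow> bool" where
  "simple_graph G \<longleftrightarrow> pair_graph G \<and> (\<forall>v\<in>pverts G. out_degree G v > 0)"

definition degree_seq :: "'a pair_pre_digraph \<Rightarrow> nat list" where
  "degree_seq G =
     rev (sorted_list_of_multiset (image_mset (out_degree G) (mset_set (pverts G))))"

definition complement :: "'a pair_pre_digraph \<Rightarrow> 'a pair_pre_digraph" where
  "complement G = \<lparr> pverts = pverts G,
     parcs = {(u, v). u \<in> pverts G \<and> v \<in> pverts G \<and> u \<noteq> v \<and> (u, v) \<notin> parcs G} \<rparr>"

definition clique :: "'a pair_pre_digraph \<Rightarrow> 'a set \<Rightarrow> bool" where
  "clique G C \<longleftrightarrow> C \<subseteq> pverts G \<and> (\<forall>u\<in>C. \<forall>v\<in>C. u \<noteq> v \<longrightarrow> (u, v) \<in> parcs G)"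

definition stable :: "'a pair_pre_digraph \<Rightarrow> 'a set \<Rightarrow> bool" where
  "stable G S \<longleftrightarrow> S \<subseteq> pverts G \<and> (\<forall>u\<in>S. \<forall>v\<in>S. (u, v) \<notin> parcs G)"

definition clique_number :: "'a pair_pre_digraph \<Rightarrow> nat" where
  "clique_number G = Max (card ` {C. clique G C})"

definition stable_number :: "'a pair_pre_digraph \<Rightarrow> nat" where
  "stable_number G = Max (card ` {S. stable G S})"

definition colorable :: "'a pair_pre_digraph \<Rightarrow> nat \<Rightarrow> bool" where
  "colorable G k \<longleftrightarrow> (\<exists>c :: 'a \<Rightarrow> nat. (\<forall>v\<in>pverts G. c v < k) \<and>
     (\<forall>(u, v)\<in>parcs G. c u \<noteq> c v))"

definition chromatic_number :: "'a pair_pre_digraph \<Rightarrow> nat" where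
  "chromatic_number G = (LEAST k. colorable G k)"

definition KS_partition :: "'a pair_pre_digraph \<Rightarrow> 'a set \<Rightarrow> 'a set \<Rightarrow> bool" where
  "KS_partition G K S \<longleftrightarrow> K \<union> S = pverts G \<and> K \<inter> S = {} \<and> clique G K \<and> stable G S"

definition split_graph :: "'a pair_pre_digraph \<Rightarrow> bool" where
  "split_graph G \<longleftrightarrow> simple_graph G \<and> (\<exists>K S. KS_partition G K S)"

definition balanced_split :: "'a pair_pre_digraph \<Rightarrow> bool" where
  "balanced_split G \<longleftrightarrow> split_graph G \<and>
     (\<exists>K S. KS_partition G K S \<and> card K = clique_number G \<and> card S = stable_number G)"

definition unbalanced_split :: "'a pair_pre_digraph \<Rightarrow> bool" where
  "unbalanced_split G \<longleftrightarrow> split_graph G \<and> \<not> balanced_split G"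

definition NG_graph :: "'a pair_pre_digraph \<Rightarrow> bool" where
  "NG_graph G \<longleftrightarrow> simple_graph G \<and>
     chromatic_number G + chromatic_number (complement G) = card (pverts G) + 1"

definition A_part :: "'a pair_pre_digraph \<Rightarrow> 'a set" where
  "A_part G = {v \<in> pverts G. out_degree G v = chromatic_number G - 1}"

definition NG1_graph :: "'a pair_pre_digraph \<Rightarrow> bool" where
  "NG1_graph G \<longleftrightarrow> NG_graph G \<and> clique G (A_part G)"

definition NG2_graph :: "'a pair_pre_digraph \<Rightarrow> bool" where
  "NG2_graph G \<longleftrightarrow> NG_graph G \<and> stable G (A_part G)"


section \<open>Classes of S-blocks\<close>

text \<open>Vertices are taken to be natural numbers; every finite graph is isomorphic to such a
  graph.\<close>

definition block_of :: "nat pair_pre_digraph \<Rightarrow> nat list \<times> nat list" where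
  "block_of G = (alpha_of (degree_seq G), beta_of (degree_seq G))"

definition unbalanced_block :: "nat list \<times> nat list \<Rightarrow> bool" where
  "unbalanced_block B \<longleftrightarrow> (\<exists>G. unbalanced_split G \<and> block_of G = B)"

definition NG1_block :: "nat list \<times> nat list \<Rightarrow> bool" where
  "NG1_block B \<longleftrightarrow> (\<exists>G. NG1_graph G \<and> block_of G = B)"

definition NG2_block :: "nat list \<times> nat list \<Rightarrow> bool" where
  "NG2_block B \<longleftrightarrow> (\<exists>G. NG2_graph G \<and> block_of G = B)"

end

theory Submission
  imports Defs
begin

text \<open>For an unbalanced block, both properties can be read off the last parts: \<open>[\<alpha>|\<beta>]\<close> is NG-1
  iff the last part of \<open>\<beta>\<close> is 1, and NG-2 iff the last part of \<open>\<alpha>\<close> exceeds 1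
  (\<open>NG_block_iff_last\<close>). The order moves the last parts in the right direction. Dominance between
  partitions of the same number forces the dominating one to be no longer
  (\<open>dominates_part_length_le\<close>). In an unbalanced block the two partitions have equal length
  (\<open>unbalanced_block_length_eq\<close>), so the opposite directions of the order in the two components
  make all four partitions equally long. Since the totals agree, larger initial sums mean a smaller
  last part (\<open>dominates_part_last_le\<close>). Hence passing to a smaller block can only enlarge the last
  part of \<open>\<alpha>\<close> and shrink that of \<open>\<beta>\<close>, which preserves ``greater than 1'' and ``equal to 1''.

  The criterion on last parts comes from the Ferrers diagram of the degree sequence, cut along its
  diagonal: \<open>\<alpha>\<close> counts the cells on and to the right of the diagonal and \<open>\<beta>\<close> those below it. Let
  \<open>b\<close> be the length of \<open>\<beta>\<close>. By \<open>ferrers_halves\<close>, equality of the two totals says that the \<open>b + 1\<close>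
  largest degrees exceed the remaining ones in sum by exactly \<open>b (b + 1)\<close>. That is the extreme case
  of a double count of edges, so \<^emph>\<open>every\<close> graph with this degree sequence is split, the \<open>b + 1\<close>
  vertices of largest degree forming a clique \<open>K\<close> and the others a stable set \<open>S\<close>
  (\<open>KS_partition_block\<close>).

  Degrees in \<open>K\<close> are at least \<open>b\<close> and degrees in \<open>S\<close> at most \<open>b\<close>. If \<open>\<alpha>\<close> is longer than \<open>\<beta>\<close>, degrees
  in \<open>K\<close> even exceed \<open>b\<close>, and the graph is balanced. If the lengths agree, some \<open>v \<in> K\<close> has
  degree \<open>b\<close> and thus no neighbour in \<open>S\<close>; then \<open>K\<close> is a clique and \<open>S \<union> {v}\<close> a stable set, and both
  chromatic numbers are read off: \<open>b + 1\<close> and \<open>|S| + 1\<close>. So the graph is an NG-graph and \<open>A\<close> consists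
  of the vertices of degree \<open>b\<close>. Two vertices of \<open>K\<close> are adjacent while \<open>v\<close> is adjacent to no vertex
  of \<open>S\<close>, so \<open>A\<close> is a clique iff no vertex of \<open>S\<close> has degree \<open>b\<close>, and stable iff \<open>v\<close> is the
  only vertex of \<open>K\<close> with degree \<open>b\<close>. These are the conditions on the last parts of \<open>\<beta>\<close> and \<open>\<alpha>\<close>.\<close>

section \<open>Dominance between partitions into distinct parts\<close>

text \<open>If \<open>\<delta>\<close> were longer, its initial segment of length \<open>length \<gamma>\<close> would have to sum to at least \<open>n\<close>,
  leaving nothing for its further positive parts.\<close>

lemma dominates_part_length_le:
  assumes "\<gamma> \<in> Dis n" "\<delta> \<in> Dis n" "dominates_part \<delta> \<gamma>"
  shows "length \<delta> \<le> length \<gamma>"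
proof (rule ccontr)
  let ?k = "length \<gamma>"
  assume "\<not> ?thesis"
  hence lt: "?k < length \<delta>" by simp
  from assms(3) lt have "sum_list (take ?k \<gamma>) \<le> sum_list (take ?k \<delta>)"
    unfolding dominates_part_def by (metis less_or_eq_imp_le min.absorb1 order_refl)
  with assms(1) have "n \<le> sum_list (take ?k \<delta>)" by (simp add: Dis_def)
  moreover have "sum_list (take ?k \<delta>) + sum_list (drop ?k \<delta>) = n"
    using assms(2) by (metis (mono_tags, lifting) Dis_def append_take_drop_id mem_Collect_eq sum_list_append)
  ultimately have "sum_list (drop ?k \<delta>) = 0" by linarith
  moreover have "drop ?k \<delta> = \<delta> ! ?k # drop (Suc ?k) \<delta>"
    using lt by (simp add: Cons_nth_drop_Suc)
  ultimately have "\<delta> ! ?k = 0" by simp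
  with assms(2) lt show False unfolding Dis_def
    by (metis (mono_tags, lifting) less_irrefl mem_Collect_eq nth_mem)
qed

lemma dominates_part_last_le:
  assumes "\<gamma> \<in> Dis n" "\<delta> \<in> Dis n" "dominates_part \<delta> \<gamma>"
    and "length \<delta> = length \<gamma>" "\<gamma> \<noteq> []"
  shows "last \<delta> \<le> last \<gamma>"
proof -
  have split: "sum_list (butlast xs) + last xs = n" if "xs \<in> Dis n" "xs \<noteq> []" for xs
  proof -
    have "sum_list (butlast xs @ [last xs]) = n"
      using that by (simp add: Dis_def)
    thus ?thesis by simp
  qed
  have "sum_list (take (length \<gamma> - 1) \<gamma>) \<le> sum_list (take (length \<gamma> - 1) \<delta>)"
    using assms(3,4) unfolding dominates_part_def by simp
  hence "sum_list (butlast \<gamma>) \<le> sum_list (butlast \<delta>)"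
    using assms(4) by (simp add: butlast_conv_take)
  moreover have "\<delta> \<noteq> []" using assms(4,5) by auto
  ultimately show ?thesis using split[of \<gamma>] split[of \<delta>] assms by linarith
qed

section \<open>The two halves of the Ferrers diagram\<close>

lemma filter_upt_initial_segment:
  assumes "\<And>i j. i \<le> j \<Longrightarrow> P j \<Longrightarrow> P i"
  shows "filter P [0..<n] = [0..<length (filter P [0..<n])]"
proof (induction n)
  case (Suc n)
  show ?case
  proof (cases "P n")
    case True
    hence "filter P [0..<Suc n] = [0..<Suc n]"
      using assms[OF _ True] by (intro filter_True) (simp add: less_Suc_eq_le)
    thus ?thesis by (metis diff_zero length_upt)
  next
    case False
    thus ?thesis using Suc by simp
  qed
qed simp

lemma filter_upt_bounded:
  assumes "\<And>i j. i \<le> j \<Longrightarrow> j < n \<Longrightarrow> P j \<Longrightarrow> P i"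
  defines "c \<equiv> length (filter P [0..<n])"
  shows "filter P [0..<n] = [0..<c]" and "c \<le> n" and "\<And>i. i < n \<Longrightarrow> P i \<longleftrightarrow> i < c"
proof -
  have "filter (\<lambda>j. j < n \<and> P j) [0..<n] = filter P [0..<n]"
    by (intro filter_cong) auto
  with filter_upt_initial_segment[of "\<lambda>j. j < n \<and> P j" n] assms(1)
  show eq: "filter P [0..<n] = [0..<c]" unfolding c_def by fastforce
  show "c \<le> n" unfolding c_def using length_filter_le[of P "[0..<n]"] by simp
  show "P i \<longleftrightarrow> i < c" if "i < n" for i
  proof -
    have "P i \<longleftrightarrow> i \<in> set (filter P [0..<n])" using that by auto
    thus ?thesis unfolding eq by simp
  qed
qed

text \<open>With positions counted from 0, the diagonal cell of row \<open>i\<close> lies in column \<open>i\<close>.\<close>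

lemma alpha_of_zero_based:
  "alpha_of d = map (\<lambda>i. d ! i - i) (filter (\<lambda>i. i < d ! i) [0..<length d])"
proof -
  have "[1..<length d + 1] = map Suc [0..<length d]" by (simp add: map_Suc_upt)
  thus ?thesis unfolding alpha_of_def by (simp add: filter_map o_def Suc_le_eq)
qed

lemma card_nth_ge_eq:
  "card {i \<in> {1..length d}. j \<le> d ! (i - 1)} = length (filter ((\<le>) j) d)"
proof -
  have "{i \<in> {1..length d}. j \<le> d ! (i - 1)} = Suc ` {i. i < length d \<and> j \<le> d ! i}"
  proof (intro set_eqI iffI)
    fix x assume "x \<in> {i \<in> {1..length d}. j \<le> d ! (i - 1)}"
    thus "x \<in> Suc ` {i. i < length d \<and> j \<le> d ! i}" by (intro image_eqI[of _ _ "x - 1"]) auto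
  qed auto
  thus ?thesis by (simp add: card_image length_filter_conv_card)
qed

lemma beta_of_zero_based:
  "beta_of d = map (\<lambda>j. length (filter ((\<le>) (Suc j)) d) - Suc j)
     (filter (\<lambda>j. Suc j < length (filter ((\<le>) (Suc j)) d)) [0..<length d])"
proof -
  have "[1..<length d + 1] = map Suc [0..<length d]" by (simp add: map_Suc_upt)
  thus ?thesis unfolding beta_of_def card_nth_ge_eq by (simp add: filter_map o_def)
qed

lemma less_length_filter_ge_iff:
  fixes d :: "'a :: linorder list"
  assumes "sorted_wrt (\<ge>) d"
  shows "s < length (filter ((\<le>) t) d) \<longleftrightarrow> s < length d \<and> t \<le> d ! s"
  using assms
proof (induction d arbitrary: s)
  case (Cons x d)
  have "filter ((\<le>) t) d = []" if "\<not> t \<le> x"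
    using that Cons.prems by (simp add: filter_empty_conv) (meson order_trans)
  moreover have "\<not> t \<le> d ! i" if "\<not> t \<le> x" "i < length d" for i
    using that Cons.prems nth_mem[of i d] by (metis order_trans sorted_wrt.simps(2))
  ultimately show ?case using Cons by (cases s) auto
qed simp

text \<open>Both sides count the cells in the first \<open>b\<close> columns of the diagram, by columns and by rows.\<close>

lemma sum_length_filter_ge:
  "(\<Sum>j<b. length (filter ((\<le>) (Suc j)) d)) = sum_list (map (\<lambda>x. min x b) d)"
proof (induction d)
  case (Cons x d)
  have "(\<Sum>j<b. length (filter ((\<le>) (Suc j)) (x # d)))
      = (\<Sum>j<b. (if Suc j \<le> x then 1 else 0) + length (filter ((\<le>) (Suc j)) d))"
    by (intro sum.cong) auto
  also have "\<dots> = card {j. j < b \<and> Suc j \<le> x} + sum_list (map (\<lambda>x. min x b) d)"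
    by (simp add: sum.distrib Cons sum.If_cases Int_def)
  also have "{j. j < b \<and> Suc j \<le> x} = {..<min x b}" by auto
  finally show ?case by simp
qed simp

text \<open>The length \<open>b\<close> of \<open>\<beta>\<close> is the largest number for which rows \<open>0, \<dots>, b\<close> all have at least \<open>b\<close> cells,
  so cutting after row \<open>b\<close> isolates a rectangle of \<open>b + 1\<close> rows and \<open>b\<close> columns. The part of \<open>\<alpha>\<close> in
  row \<open>i \<le> b\<close> is the row without its first \<open>i\<close> cells, which gives the fifth claim. The first \<open>b\<close>
  columns consist of the rectangle and of all rows below it, and the part of \<open>\<beta>\<close> in column \<open>j\<close> omits
  the top \<open>j + 1\<close> cells, which gives the sixth. In both cases the omitted cells form a staircase of
  size \<open>0 + \<dots> + b\<close>, so that comparing the totals of \<open>\<alpha>\<close> and \<open>\<beta>\<close> compares the degrees on the two sides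
  of the cut.\<close>

lemma ferrers_halves:
  fixes d :: "nat list"
  assumes sorted: "sorted_wrt (\<ge>) d" and "d \<noteq> []"
  defines "a \<equiv> length (alpha_of d)" and "b \<equiv> length (beta_of d)"
  shows "b < length d"
    and "\<And>x. x \<in> set (take (Suc b) d) \<Longrightarrow> b \<le> x"
    and "\<And>x. x \<in> set (drop (Suc b) d) \<Longrightarrow> x \<le> b"
    and "\<And>i. i < length d \<Longrightarrow> i < d ! i \<longleftrightarrow> i < a"
    and "sum_list (alpha_of d) + \<Sum>{..b} = sum_list (take (Suc b) d)"
    and "sum_list (beta_of d) + \<Sum>{..b} = b * Suc b + sum_list (drop (Suc b) d)"
    and "0 < a \<Longrightarrow> last (alpha_of d) = d ! (a - 1) - (a - 1)"
    and "0 < b \<Longrightarrow> last (beta_of d) = Suc (length (filter ((\<le>) b) (drop (Suc b) d)))"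
proof -
  let ?P = "\<lambda>i. i < d ! i" and ?C = "\<lambda>j. length (filter ((\<le>) (Suc j)) d)"
  let ?Q = "\<lambda>j. Suc j < ?C j"
  have mono: "d ! j \<le> d ! i" if "i \<le> j" "j < length d" for i j
    using that sorted by (cases "i = j") (auto simp: sorted_wrt_iff_nth_less)
  have P: "?P i" if "i \<le> j" "j < length d" "?P j" for i j
    using mono[OF that(1,2)] that by linarith
  have Q_iff: "?Q j \<longleftrightarrow> Suc j < length d \<and> Suc j \<le> d ! Suc j" for j
    using less_length_filter_ge_iff[OF sorted] .
  have Q: "?Q i" if "i \<le> j" "j < length d" "?Q j" for i j
    unfolding Q_iff using that mono[of "Suc i" "Suc j"] by (auto simp: Q_iff)
  have a_eq: "a = length (filter ?P [0..<length d])" and b_eq: "b = length (filter ?Q [0..<length d])"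
    unfolding a_def b_def alpha_of_zero_based beta_of_zero_based by simp_all
  have fP: "filter ?P [0..<length d] = [0..<a]" "a \<le> length d" "\<And>i. i < length d \<Longrightarrow> ?P i \<longleftrightarrow> i < a"
    using filter_upt_bounded[where n = "length d" and P = ?P] P unfolding a_eq by blast+
  have fQ: "filter ?Q [0..<length d] = [0..<b]" "b \<le> length d" "\<And>j. j < length d \<Longrightarrow> ?Q j \<longleftrightarrow> j < b"
    using filter_upt_bounded[where n = "length d" and P = ?Q] Q unfolding b_eq by blast+
  have alpha: "alpha_of d = map (\<lambda>i. d ! i - i) [0..<a]"
    unfolding alpha_of_zero_based fP(1) ..
  have beta: "beta_of d = map (\<lambda>j. ?C j - Suc j) [0..<b]"
    unfolding beta_of_zero_based fQ(1) ..
  show iff: "i < d ! i \<longleftrightarrow> i < a" if "i < length d" for i using fP(3)[OF that] .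
  have Qb: "Suc j < length d \<and> Suc j \<le> d ! Suc j" if "j < b" for j
    using fQ(2) fQ(3)[of j] that Q_iff[of j] by auto
  show b_less: "b < length d" using Qb[of "b - 1"] assms(2) by (cases b) auto
  have ge_b: "b \<le> d ! i" if "i \<le> b" for i
    using Qb[of "b - 1"] mono[of i b] b_less that by (cases b) auto
  have not_Q: "d ! Suc b \<le> b" if "Suc b < length d"
    using fQ(3)[of b] Q_iff[of b] that by auto
  have le_b: "d ! i \<le> b" if "b < i" "i < length d" for i
    using mono[of "Suc b" i] not_Q that by fastforce
  show take_ge: "b \<le> x" if "x \<in> set (take (Suc b) d)" for x
    using that ge_b by (auto simp: in_set_conv_nth less_Suc_eq_le)
  show drop_le: "x \<le> b" if "x \<in> set (drop (Suc b) d)" for x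
    using that le_b by (auto simp: in_set_conv_nth)
  have a_le: "a \<le> Suc b"
  proof (rule ccontr)
    assume "\<not> ?thesis"
    hence "Suc b < a" by simp
    with fP(2) iff[of "Suc b"] le_b[of "Suc b"] show False by simp
  qed
  have "sum_list (alpha_of d) = (\<Sum>i<a. d ! i - i)"
    unfolding alpha by (simp add: interv_sum_list_conv_sum_set_nat atLeast0LessThan)
  \<comment> \<open>A row \<open>i \<le> b\<close> without a part of \<open>\<alpha>\<close> has at most \<open>i\<close> cells; truncated subtraction makes its term 0.\<close>
  also have "\<dots> = (\<Sum>i\<le>b. d ! i - i)"
  proof (intro sum.mono_neutral_left)
    show "\<forall>i\<in>{..b} - {..<a}. d ! i - i = 0"
      using iff b_less by (metis DiffE atMost_iff diff_is_0_eq le_less_trans lessThan_iff not_less)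
  qed (use a_le in auto)
  also have "\<dots> + \<Sum>{..b} = (\<Sum>i\<le>b. d ! i)"
    unfolding sum.distrib[symmetric]
  proof (intro sum.cong)
    fix i assume "i \<in> {..b}"
    thus "d ! i - i + i = d ! i" using ge_b[of i] by simp
  qed simp
  also have "\<dots> = sum_list (take (Suc b) d)"
    using b_less by (simp add: sum_list_sum_nth min_absorb2 atLeast0LessThan lessThan_Suc_atMost)
  finally show "sum_list (alpha_of d) + \<Sum>{..b} = sum_list (take (Suc b) d)" .
  have "sum_list (beta_of d) + \<Sum>{..b} = (\<Sum>j<b. ?C j - Suc j) + (\<Sum>j<b. Suc j)"
    using sum.lessThan_Suc_shift[of "\<lambda>j. j" b]
    by (simp add: beta interv_sum_list_conv_sum_set_nat atLeast0LessThan
        flip: lessThan_Suc_atMost del: sum.lessThan_Suc)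
  also have "\<dots> = (\<Sum>j<b. ?C j)"
    unfolding sum.distrib[symmetric]
  proof (intro sum.cong)
    fix j assume "j \<in> {..<b}"
    hence "Suc j < ?C j" using Qb[of j] Q_iff[of j] by simp
    thus "?C j - Suc j + Suc j = ?C j" by simp
  qed simp
  also have "\<dots> = sum_list (map (\<lambda>x. min x b) (take (Suc b) d @ drop (Suc b) d))"
    by (simp add: sum_length_filter_ge)
  also have "\<dots> = sum_list (map (\<lambda>x. min x b) (take (Suc b) d))
      + sum_list (map (\<lambda>x. min x b) (drop (Suc b) d))"
    unfolding map_append sum_list_append ..
  also have "map (\<lambda>x. min x b) (take (Suc b) d) = map (\<lambda>x. b) (take (Suc b) d)"
    using take_ge by (intro map_cong) auto
  also have "sum_list \<dots> = b * Suc b"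
    using b_less by (simp add: sum_list_triv)
  also have "map (\<lambda>x. min x b) (drop (Suc b) d) = drop (Suc b) d"
    using drop_le by (intro map_idI) auto
  finally show "sum_list (beta_of d) + \<Sum>{..b} = b * Suc b + sum_list (drop (Suc b) d)" .
  show "last (alpha_of d) = d ! (a - 1) - (a - 1)" if "0 < a"
    unfolding alpha using that by (simp add: last_map)
  show "last (beta_of d) = Suc (length (filter ((\<le>) b) (drop (Suc b) d)))" if "0 < b"
  proof -
    have "last (beta_of d) = length (filter ((\<le>) b) (take (Suc b) d @ drop (Suc b) d)) - b"
      unfolding beta using that by (simp add: last_map)
    also have "\<dots> = length (filter ((\<le>) b) (take (Suc b) d))
        + length (filter ((\<le>) b) (drop (Suc b) d)) - b"
      unfolding filter_append length_append ..
    also have "filter ((\<le>) b) (take (Suc b) d) = take (Suc b) d"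
      using take_ge by (intro filter_True) auto
    finally show ?thesis using b_less by simp
  qed
qed

section \<open>Degrees and the split partition\<close>

lemma out_degree_eq_card: "out_degree (with_proj G) v = card {w. (v, w) \<in> parcs G}"
proof -
  have "out_arcs (with_proj G) v = Pair v ` {w. (v, w) \<in> parcs G}"
    by (auto simp: out_arcs_def)
  thus ?thesis by (simp add: out_degree_def card_image inj_on_def)
qed

lemma simple_graphD:
  assumes "simple_graph G"
  shows "finite (pverts G)" "(u, v) \<in> parcs G \<Longrightarrow> (v, u) \<in> parcs G" "(v, v) \<notin> parcs G"
    "parcs G \<subseteq> pverts G \<times> pverts G"
proof -
  interpret pair_graph G using assms by (simp add: simple_graph_def)
  show "finite (pverts G)" by simp
  show "(u, v) \<in> parcs G \<Longrightarrow> (v, u) \<in> parcs G" by (rule arcs_symmetric)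
  show "(v, v) \<notin> parcs G" using no_loops by fastforce
  show "parcs G \<subseteq> pverts G \<times> pverts G" using wellformed' by auto
qed

lemma degree_seq_enumeration:
  assumes "finite (pverts G)"
  obtains vs where "distinct vs" "set vs = pverts G" "degree_seq G = map (out_degree (with_proj G)) vs"
    "sorted_wrt (\<ge>) (degree_seq G)"
proof -
  from assms obtain us where us: "set us = pverts G" "distinct us"
    using finite_distinct_list by blast
  define vs where "vs = rev (sort_key (out_degree (with_proj G)) us)"
  have mset: "mset_set (pverts G) = mset us" using us by (metis mset_set_set)
  have "sorted_list_of_multiset (image_mset (out_degree (with_proj G)) (mset us))
      = sort (map (out_degree (with_proj G)) us)"
    by (metis mset_map sorted_list_of_multiset_mset)
  also have "\<dots> = map (out_degree (with_proj G)) (sort_key (out_degree (with_proj G)) us)"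
    by (rule properties_for_sort) simp_all
  finally have eq: "degree_seq G = map (out_degree (with_proj G)) vs"
    unfolding degree_seq_def mset vs_def by (simp add: rev_map)
  show thesis
  proof
    show "sorted_wrt (\<ge>) (degree_seq G)"
      unfolding degree_seq_def by (simp add: sorted_wrt_rev)
  qed (use us eq in \<open>auto simp: vs_def\<close>)
qed

text \<open>Edges between \<open>K\<close> and \<open>S\<close> contribute equally to both degree sums, so the difference of the sums
  is twice the number of edges inside \<open>K\<close> minus twice the number inside \<open>S\<close>. It is at most
  \<open>|K| (|K| - 1)\<close>, and reaching this bound requires all edges inside \<open>K\<close> and none inside \<open>S\<close>.\<close>

lemma KS_partition_if_degree_sums:
  assumes G: "simple_graph G" and part: "K \<union> S = pverts G" "K \<inter> S = {}"
    and sums: "card K * (card K - 1) + (\<Sum>v\<in>S. out_degree (with_proj G) v)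
      \<le> (\<Sum>v\<in>K. out_degree (with_proj G) v)"
  shows "KS_partition G K S"
proof -
  note G' = simple_graphD[OF G]
  let ?e = "\<lambda>v X. card {w\<in>X. (v, w) \<in> parcs G}"
  have fin: "finite K" "finite S" using part G'(1) by (metis finite_Un)+
  have deg: "out_degree (with_proj G) v = ?e v K + ?e v S" for v
  proof -
    have eq: "{w. (v, w) \<in> parcs G} = {w\<in>K. (v, w) \<in> parcs G} \<union> {w\<in>S. (v, w) \<in> parcs G}"
      using G'(4) part(1) by auto
    show ?thesis unfolding out_degree_eq_card eq
      by (rule card_Un_disjoint) (use fin part(2) in auto)
  qed
  have "(\<Sum>v\<in>K. ?e v S) = (\<Sum>v\<in>S. card {w\<in>K. (w, v) \<in> parcs G})"
    using sum_multicount_gen[OF fin, of "\<lambda>v w. (v, w) \<in> parcs G"] by simp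
  also have "\<dots> = (\<Sum>v\<in>S. ?e v K)"
    using G'(2) by (intro sum.cong arg_cong[where f = card]) auto
  finally have cross: "(\<Sum>v\<in>K. ?e v S) = (\<Sum>v\<in>S. ?e v K)" .
  have le: "?e v K \<le> card K - 1" if "v \<in> K" for v
  proof -
    have "?e v K \<le> card (K - {v})" using fin G'(3) by (intro card_mono) auto
    thus ?thesis using that fin by simp
  qed
  have inner: "card K * (card K - 1) + (\<Sum>v\<in>S. ?e v S) \<le> (\<Sum>v\<in>K. ?e v K)"
    using sums cross unfolding deg sum.distrib by simp
  moreover have "(\<Sum>v\<in>K. ?e v K) \<le> card K * (card K - 1)"
    using sum_mono[OF le, of K] by simp
  ultimately have S0: "(\<Sum>v\<in>S. ?e v S) = 0" and K_eq: "(\<Sum>v\<in>K. ?e v K) = (\<Sum>v\<in>K. card K - 1)"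
    by simp_all
  have "stable G S" unfolding stable_def
    using S0 fin part(1) by auto
  moreover have "clique G K" unfolding clique_def
  proof (intro conjI ballI impI)
    fix u v assume uv: "u \<in> K" "v \<in> K" "u \<noteq> v"
    have "?e u K = card K - 1"
      using sum_mono_inv[OF K_eq le] uv fin by blast
    hence "?e u K = card (K - {u})" using uv fin by simp
    hence "{w\<in>K. (u, w) \<in> parcs G} = K - {u}"
      using fin G'(3) by (intro card_subset_eq) auto
    thus "(u, v) \<in> parcs G" using uv by blast
  qed (use part in auto)
  ultimately show ?thesis using part by (simp add: KS_partition_def)
qed

section \<open>Chromatic numbers of unbalanced split graphs\<close>

text \<open>Colour \<open>K\<close> injectively and give all of \<open>T\<close> the colour of the common vertex \<open>v\<close>. A stable set
  containing \<open>v\<close> keeps this proper, and the clique \<open>K\<close> needs that many colours.\<close>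

lemma chromatic_number_clique_stable_cover:
  assumes "finite (pverts G)" and "parcs G \<subseteq> pverts G \<times> pverts G" and "\<And>v. (v, v) \<notin> parcs G"
    and "clique G K" "stable G T" "K \<union> T = pverts G" "K \<inter> T = {v}"
  shows "chromatic_number G = card K"
proof -
  have fin: "finite K" using assms(1,6) by (metis finite_Un)
  have vK: "v \<in> K" "v \<in> T" using assms(7) by auto
  show ?thesis unfolding chromatic_number_def
  proof (rule Least_equality)
    obtain f where "bij_betw f K {0..<card K}" using ex_bij_betw_finite_nat[OF fin] by blast
    hence inj: "inj_on f K" and range: "\<And>u. u \<in> K \<Longrightarrow> f u < card K"
      by (auto simp: bij_betw_def)
    define c where "c u = (if u \<in> K then f u else f v)" for u
    have proper: "c u \<noteq> c w" if "(u, w) \<in> parcs G" for u w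
    proof
      assume "c u = c w"
      moreover have "u \<in> K \<union> T" "w \<in> K \<union> T" using that assms(2,6) by auto
      ultimately have "u = w \<or> u \<in> T \<and> w \<in> T"
        using inj vK by (auto simp: c_def inj_on_def split: if_splits)
      with that assms(3,5) show False by (auto simp: stable_def)
    qed
    show "colorable G (card K)" unfolding colorable_def
    proof (intro exI conjI)
      show "\<forall>u\<in>pverts G. c u < card K" using range vK by (auto simp: c_def)
      show "\<forall>(u, w)\<in>parcs G. c u \<noteq> c w" using proper by blast
    qed
  next
    fix k assume "colorable G k"
    then obtain c :: "'a \<Rightarrow> nat" where c: "\<forall>v\<in>pverts G. c v < k" "\<forall>(u, v)\<in>parcs G. c u \<noteq> c v"
      unfolding colorable_def by blast
    have "inj_on c K" "c ` K \<subseteq> {..<k}" using c assms(4,6) by (fastforce simp: clique_def inj_on_def)+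
    thus "card K \<le> k" using card_inj_on_le[of c K "{..<k}"] by simp
  qed
qed


text \<open>Complementation exchanges cliques and stable sets, so \<open>chromatic_number_clique_stable_cover\<close>
  also gives \<open>|T|\<close> as the chromatic number of the complement; the common vertex \<open>v\<close> is counted twice
  in \<open>|K| + |T|\<close>.\<close>

lemma NG_graph_clique_stable_cover:
  assumes G: "simple_graph G"
    and "clique G K" "stable G T" "K \<union> T = pverts G" "K \<inter> T = {v}"
  shows "NG_graph G" and "chromatic_number G = card K"
proof -
  note G' = simple_graphD[OF G]
  show chi: "chromatic_number G = card K"
    using chromatic_number_clique_stable_cover[OF G'(1,4,3)] assms(2-5) by blast
  have "chromatic_number (complement G) = card T"
  proof (rule chromatic_number_clique_stable_cover)
    show "clique (complement G) T" using assms(3) by (auto simp: clique_def stable_def complement_def)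
    show "stable (complement G) K" using assms(2) by (auto simp: clique_def stable_def complement_def)
    show "T \<union> K = pverts (complement G)" "T \<inter> K = {v}" using assms(4,5) by (auto simp: complement_def)
  qed (use G' in \<open>auto simp: complement_def\<close>)
  moreover have "card K + card T = card (pverts G) + 1"
    using card_Un_Int[of K T] assms(4,5) G'(1) by (metis card_1_singleton_iff finite_Un One_nat_def)
  ultimately show "NG_graph G" using G chi by (simp add: NG_graph_def)
qed

section \<open>From a block to the structure of its graphs\<close>

text \<open>This transfers \<open>ferrers_halves\<close> to vertices: \<open>K\<close> holds the vertices of the first \<open>length \<beta> + 1\<close>
  rows, and \<open>v\<close> is the vertex of the last of these rows, so that all degrees in \<open>K\<close> are bounded below
  by that of \<open>v\<close>. Ties in degree may occur across the cut, so \<open>K\<close> is chosen by an enumeration of the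
  vertices and not by a bound on the degree.\<close>

lemma KS_partition_block:
  assumes G: "simple_graph G" and block: "block_of G = (\<alpha>, \<beta>)"
    and sums: "sum_list \<alpha> = sum_list \<beta>" "sum_list \<alpha> > 0"
  obtains K S v where "KS_partition G K S" "card K = Suc (length \<beta>)"
    and "v \<in> K" "\<forall>u\<in>K. out_degree (with_proj G) v \<le> out_degree (with_proj G) u"
    and "length \<beta> \<le> out_degree (with_proj G) v"
    and "\<forall>s\<in>S. out_degree (with_proj G) s \<le> length \<beta>"
    and "length \<beta> < out_degree (with_proj G) v \<longleftrightarrow> length \<beta> < length \<alpha>"
    and "length \<alpha> = length \<beta> \<Longrightarrow>
      last \<alpha> > 1 \<longleftrightarrow> (\<forall>u\<in>K - {v}. length \<beta> < out_degree (with_proj G) u)"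
    and "last \<beta> = 1 \<longleftrightarrow> (\<forall>s\<in>S. out_degree (with_proj G) s < length \<beta>)"
proof -
  note G' = simple_graphD[OF G]
  let ?deg = "out_degree (with_proj G)"
  obtain vs where vs: "distinct vs" "set vs = pverts G" "degree_seq G = map ?deg vs"
    "sorted_wrt (\<ge>) (degree_seq G)"
    using degree_seq_enumeration[OF G'(1)] .
  define d where "d = degree_seq G"
  have d: "d = map ?deg vs" "sorted_wrt (\<ge>) d" using vs by (simp_all add: d_def)
  have \<alpha>\<beta>: "alpha_of d = \<alpha>" "beta_of d = \<beta>" using block by (simp_all add: block_of_def d_def)
  have \<beta>_ne: "\<beta> \<noteq> []" using sums by auto
  have ne: "d \<noteq> []" using sums(2) \<alpha>\<beta>(1)[symmetric] by (auto simp: alpha_of_def)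
  define a b where "a = length \<alpha>" and "b = length \<beta>"
  note F = ferrers_halves[OF d(2) ne, unfolded \<alpha>\<beta>, folded a_def b_def]
  have nth_d: "d ! i = ?deg (vs ! i)" if "i < length vs" for i using that by (simp add: d)
  have b_less: "b < length vs" using F(1) by (simp add: d)
  define K S v where "K = set (take (Suc b) vs)" and "S = set (drop (Suc b) vs)" and "v = vs ! b"
  have K_nth: "K = {vs ! i | i. i \<le> b}"
  proof -
    have "K = (!) vs ` {0..<Suc b}" unfolding K_def using nth_image[of "Suc b" vs] b_less by simp
    thus ?thesis by (auto simp: less_Suc_eq_le)
  qed
  have "K \<union> S = pverts G" unfolding K_def S_def vs(2)[symmetric] by (metis append_take_drop_id set_append)
  moreover have "K \<inter> S = {}" unfolding K_def S_def using vs(1) by (simp add: set_take_disj_set_drop_if_distinct)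
  moreover have card_K: "card K = Suc b" unfolding K_def using vs(1) b_less by (simp add: distinct_card)
  moreover have "sum_list (take (Suc b) d) = (\<Sum>v\<in>K. ?deg v)" "sum_list (drop (Suc b) d) = (\<Sum>v\<in>S. ?deg v)"
    unfolding K_def S_def d(1) take_map drop_map using vs(1) by (simp_all add: sum_list_distinct_conv_sum_set)
  ultimately have KS: "KS_partition G K S"
    using F(5,6) sums(1) by (intro KS_partition_if_degree_sums[OF G]) simp_all
  have deg_v: "?deg v = d ! b" using nth_d b_less by (simp add: v_def)
  have mono: "d ! j \<le> d ! i" if "i \<le> j" "j < length d" for i j
    using that d(2) by (cases "i = j") (auto simp: sorted_wrt_iff_nth_less)
  show thesis
  proof (rule that[of K S v, folded b_def a_def])
    show "KS_partition G K S" "card K = Suc b" by fact+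
    show "v \<in> K" unfolding K_nth v_def by blast
    show "\<forall>u\<in>K. ?deg v \<le> ?deg u"
      using mono[of _ b] nth_d b_less unfolding deg_v K_nth by (auto simp: d)
    show "b \<le> ?deg v" using F(2) \<open>v \<in> K\<close> unfolding K_def d(1) take_map by auto
    show "\<forall>s\<in>S. ?deg s \<le> b"
      using F(3) unfolding S_def d(1) drop_map by auto
    show "b < ?deg v \<longleftrightarrow> b < a" using F(4)[of b] F(1) by (simp add: deg_v)
    show "last \<beta> = 1 \<longleftrightarrow> (\<forall>s\<in>S. ?deg s < b)"
    proof -
      have "last \<beta> = Suc (length (filter ((\<le>) b) (drop (Suc b) d)))"
        using F(8) \<beta>_ne by (simp add: b_def)
      thus ?thesis unfolding S_def d(1) drop_map by (auto simp: filter_empty_conv not_le)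
    qed
    show "last \<alpha> > 1 \<longleftrightarrow> (\<forall>u\<in>K - {v}. b < ?deg u)" if "a = b"
    proof -
      have b: "0 < b" using \<beta>_ne by (simp add: b_def)
      \<comment> \<open>The last part of \<open>\<alpha>\<close> sits in the row above that of \<open>v\<close>.\<close>
      have "last \<alpha> = d ! (b - 1) - (b - 1)" using F(7) b that by simp
      hence "last \<alpha> > 1 \<longleftrightarrow> b < d ! (b - 1)" using b by linarith
      also have "\<dots> \<longleftrightarrow> (\<forall>i<b. b < d ! i)"
      proof (intro iffI allI impI)
        fix i assume "b < d ! (b - 1)" "i < b"
        thus "b < d ! i" using mono[of i "b - 1"] F(1) by linarith
      qed (use b in simp)
      also have "\<dots> \<longleftrightarrow> (\<forall>u\<in>{vs ! i | i. i < b}. b < ?deg u)"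
        using nth_d b_less by auto
      also have "{vs ! i | i. i < b} = K - {v}"
        unfolding K_nth v_def using vs(1) b_less by (auto simp: nth_eq_iff_index_eq nat_less_le)
      finally show ?thesis .
    qed
  qed
qed

text \<open>A clique that meets \<open>S\<close> has at most one vertex more than the degree of such a vertex, hence at most
  \<open>|K|\<close> vertices. A stable set that meets \<open>K\<close> misses the at least \<open>|K|\<close> neighbours of such a vertex,
  hence has at most \<open>|S|\<close> vertices.\<close>

lemma balanced_split_if_degree_gap:
  assumes G: "simple_graph G" and KS: "KS_partition G K S"
    and K: "\<And>u. u \<in> K \<Longrightarrow> card K \<le> out_degree (with_proj G) u"
    and S: "\<And>s. s \<in> S \<Longrightarrow> out_degree (with_proj G) s < card K"
  shows "balanced_split G"
proof -
  note G' = simple_graphD[OF G]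
  have part: "K \<union> S = pverts G" "K \<inter> S = {}" "clique G K" "stable G S"
    using KS by (simp_all add: KS_partition_def)
  have fin: "finite C" if "C \<subseteq> pverts G" for C using that G'(1) finite_subset by blast
  have fin_nbrs: "finite {w. (u, w) \<in> parcs G}" for u
    by (rule finite_subset[OF _ G'(1)]) (use G'(4) in auto)
  have card_clique: "card C \<le> card K" if C: "clique G C" for C
  proof (cases "C \<subseteq> K")
    case True
    thus ?thesis using fin[of K] part(1) by (intro card_mono) auto
  next
    case False
    have CV: "C \<subseteq> pverts G" using C by (simp add: clique_def)
    from False CV part(1) obtain s where s: "s \<in> C" "s \<in> S" by auto
    have "C - {s} \<subseteq> {w. (s, w) \<in> parcs G}" using C s by (auto simp: clique_def)
    hence "card (C - {s}) \<le> out_degree (with_proj G) s"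
      unfolding out_degree_eq_card by (intro card_mono fin_nbrs)
    thus ?thesis using S[OF s(2)] s(1) fin[OF CV] by simp
  qed
  have card_stable: "card T \<le> card S" if T: "stable G T" for T
  proof (cases "T \<subseteq> S")
    case True
    thus ?thesis using fin[of S] part(1) by (intro card_mono) auto
  next
    case False
    have TV: "T \<subseteq> pverts G" using T by (simp add: stable_def)
    from False TV part(1) obtain u where u: "u \<in> T" "u \<in> K" by auto
    let ?N = "{w. (u, w) \<in> parcs G}"
    have "card T + card ?N = card (T \<union> ?N)"
      using T u fin[OF TV] fin_nbrs by (intro card_Un_disjoint[symmetric]) (auto simp: stable_def)
    also have "\<dots> \<le> card (pverts G)" using TV G'(1,4) by (intro card_mono) auto
    also have "\<dots> = card K + card S"
      using part(1,2) fin[of K] fin[of S] by (metis Un_upper1 Un_upper2 card_Un_disjoint)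
    finally show ?thesis using K[OF u(2)] by (simp add: out_degree_eq_card)
  qed
  have fin_fam: "finite {C. clique G C}" "finite {T. stable G T}"
    by (rule finite_subset[of _ "Pow (pverts G)"]; use G'(1) in \<open>auto simp: clique_def stable_def\<close>)+
  have "clique_number G = card K" unfolding clique_number_def
    by (rule Max_eqI) (use fin_fam card_clique part in auto)
  moreover have "stable_number G = card S" unfolding stable_number_def
    by (rule Max_eqI) (use fin_fam card_stable part in auto)
  ultimately show ?thesis unfolding balanced_split_def split_graph_def using G KS by auto
qed

text \<open>If \<open>\<alpha>\<close> had the extra part, the diagonal cell of row \<open>length \<beta>\<close> would be present. All degrees in \<open>K\<close>
  would then reach \<open>|K|\<close>, while those in \<open>S\<close> stay below.\<close>

lemma unbalanced_block_length_eq: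
  assumes "(\<alpha>, \<beta>) \<in> S_Block n" "n > 0" "unbalanced_block (\<alpha>, \<beta>)"
  shows "length \<alpha> = length \<beta>"
proof (rule ccontr)
  assume "length \<alpha> \<noteq> length \<beta>"
  with assms(1) have len: "length \<alpha> = Suc (length \<beta>)" and sums: "sum_list \<alpha> = n" "sum_list \<beta> = n"
    by (auto simp: S_Block_def Dis_def)
  from assms(3) obtain G where G: "unbalanced_split G" "block_of G = (\<alpha>, \<beta>)"
    by (auto simp: unbalanced_block_def)
  hence simple: "simple_graph G" by (simp add: unbalanced_split_def split_graph_def)
  obtain K S v where KS: "KS_partition G K S" "card K = Suc (length \<beta>)"
    and K: "\<forall>u\<in>K. out_degree (with_proj G) v \<le> out_degree (with_proj G) u"
    and S: "\<forall>s\<in>S. out_degree (with_proj G) s \<le> length \<beta>"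
    and gap: "length \<beta> < out_degree (with_proj G) v \<longleftrightarrow> length \<beta> < length \<alpha>"
    by (rule KS_partition_block[OF simple G(2)]) (use sums assms(2) in simp, use sums assms(2) in simp, rule that)
  have "balanced_split G"
  proof (rule balanced_split_if_degree_gap[OF simple KS(1)])
    show "card K \<le> out_degree (with_proj G) u" if "u \<in> K" for u
      using K that gap len KS(2) by fastforce
    show "out_degree (with_proj G) s < card K" if "s \<in> S" for s
      using S that KS(2) by fastforce
  qed
  with G(1) show False by (simp add: unbalanced_split_def)
qed

text \<open>Since the lengths agree, the vertex \<open>v\<close> from \<open>KS_partition_block\<close> has degree \<open>|K| - 1\<close>. Its
  neighbours in \<open>K\<close> account for all of it, so \<open>v\<close> can be moved to \<open>S\<close>. This makes the graph an NG-graph,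
  and \<open>A_part G\<close> is a clique or stable according to which side of the
  partition supplies further vertices of degree \<open>length \<beta>\<close>.\<close>

lemma NG_classes_of_block:
  assumes G: "simple_graph G" and block: "block_of G = (\<alpha>, \<beta>)"
    and sums: "sum_list \<alpha> = sum_list \<beta>" "sum_list \<alpha> > 0" and len: "length \<alpha> = length \<beta>"
  shows "NG1_graph G \<longleftrightarrow> last \<beta> = 1" and "NG2_graph G \<longleftrightarrow> last \<alpha> > 1"
proof -
  note G' = simple_graphD[OF G]
  let ?deg = "out_degree (with_proj G)" and ?b = "length \<beta>"
  obtain K S v where KS: "KS_partition G K S" and card_K: "card K = Suc ?b"
    and v: "v \<in> K" "\<forall>u\<in>K. ?deg v \<le> ?deg u" "?b \<le> ?deg v"
    and S: "\<forall>s\<in>S. ?deg s \<le> ?b"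
    and gap: "?b < ?deg v \<longleftrightarrow> ?b < length \<alpha>"
    and last_\<alpha>: "length \<alpha> = ?b \<Longrightarrow> last \<alpha> > 1 \<longleftrightarrow> (\<forall>u\<in>K - {v}. ?b < ?deg u)"
    and last_\<beta>: "last \<beta> = 1 \<longleftrightarrow> (\<forall>s\<in>S. ?deg s < ?b)"
    by (rule KS_partition_block[OF G block sums]) (rule that)
  have part: "K \<union> S = pverts G" "K \<inter> S = {}" "clique G K" "stable G S"
    using KS by (simp_all add: KS_partition_def)
  have fin: "finite K" using card_K by (simp add: card_ge_0_finite)
  have deg_v: "?deg v = ?b" using v(3) gap len by simp
  have nbrs_v: "{w. (v, w) \<in> parcs G} = K - {v}"
  proof (rule card_subset_eq[symmetric])
    show "finite {w. (v, w) \<in> parcs G}"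
      by (rule finite_subset[OF _ G'(1)]) (use G'(4) in auto)
    show "K - {v} \<subseteq> {w. (v, w) \<in> parcs G}" using part(3) v(1) by (auto simp: clique_def)
    show "card (K - {v}) = card {w. (v, w) \<in> parcs G}"
      using deg_v card_K v(1) fin by (simp add: out_degree_eq_card)
  qed
  have no_arc: "(v, s) \<notin> parcs G" "(s, v) \<notin> parcs G" if "s \<in> S" for s
    using that nbrs_v part(2) G'(2) by blast+
  have stable: "stable G (insert v S)"
    using part(1,4) v(1) no_arc G'(3) by (auto simp: stable_def)
  have NG: "NG_graph G" and chi: "chromatic_number G = card K"
    using NG_graph_clique_stable_cover[OF G part(3) stable, of v] part(1,2) v(1) by auto
  have A: "A_part G = {u \<in> K \<union> S. ?deg u = ?b}"
    unfolding A_part_def chi part(1) card_K by simp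
  have "clique G (A_part G) \<longleftrightarrow> (\<forall>s\<in>S. ?deg s < ?b)"
  proof
    assume C: "clique G (A_part G)"
    show "\<forall>s\<in>S. ?deg s < ?b"
    proof
      fix s assume s: "s \<in> S"
      have "s \<notin> A_part G"
      proof
        assume "s \<in> A_part G"
        moreover have "v \<in> A_part G" using A v(1) deg_v by simp
        moreover have "v \<noteq> s" using s v(1) part(2) by blast
        ultimately show False using C no_arc(1)[OF s] by (auto simp: clique_def)
      qed
      thus "?deg s < ?b" using A S s le_neq_implies_less by blast
    qed
  next
    assume "\<forall>s\<in>S. ?deg s < ?b"
    hence "A_part G \<subseteq> K" using A by auto
    thus "clique G (A_part G)" using part(3) by (auto simp: clique_def)
  qed
  thus "NG1_graph G \<longleftrightarrow> last \<beta> = 1" unfolding NG1_graph_def last_\<beta> using NG by simp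
  have "stable G (A_part G) \<longleftrightarrow> (\<forall>u\<in>K - {v}. ?b < ?deg u)"
  proof
    assume St: "stable G (A_part G)"
    show "\<forall>u\<in>K - {v}. ?b < ?deg u"
    proof
      fix u assume u: "u \<in> K - {v}"
      have "(v, u) \<in> parcs G" using u nbrs_v by blast
      moreover have "v \<in> A_part G" using A v(1) deg_v by simp
      ultimately have "u \<notin> A_part G" using St by (auto simp: stable_def)
      thus "?b < ?deg u" using A u v(2) deg_v le_neq_implies_less by auto
    qed
  next
    assume "\<forall>u\<in>K - {v}. ?b < ?deg u"
    hence "u = v" if "u \<in> K" "?deg u = ?b" for u
      using that by (metis DiffI less_irrefl singletonD)
    hence "A_part G \<subseteq> insert v S" using A by blast
    thus "stable G (A_part G)" using stable unfolding stable_def by blast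
  qed
  thus "NG2_graph G \<longleftrightarrow> last \<alpha> > 1" unfolding NG2_graph_def last_\<alpha>[OF len] using NG by simp
qed

text \<open>The criterion of \<open>NG_classes_of_block\<close> mentions only \<open>\<alpha>\<close> and \<open>\<beta>\<close>. All graphs with this block
  therefore fall into the same NG classes, and the unbalanced graph at hand can serve as the witness
  when the last parts are right.\<close>

lemma NG_block_iff_last:
  assumes B: "(\<alpha>, \<beta>) \<in> S_Block n" "n > 0" "unbalanced_block (\<alpha>, \<beta>)"
  shows "NG1_block (\<alpha>, \<beta>) \<longleftrightarrow> last \<beta> = 1" and "NG2_block (\<alpha>, \<beta>) \<longleftrightarrow> last \<alpha> > 1"
proof -
  have sums: "sum_list \<alpha> = sum_list \<beta>" "sum_list \<alpha> > 0"
    using B(1,2) by (auto simp: S_Block_def Dis_def)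
  note iff = NG_classes_of_block[OF _ _ sums unbalanced_block_length_eq[OF B]]
  obtain G where G: "simple_graph G" "block_of G = (\<alpha>, \<beta>)"
    using B(3) by (auto simp: unbalanced_block_def unbalanced_split_def split_graph_def)
  show "NG1_block (\<alpha>, \<beta>) \<longleftrightarrow> last \<beta> = 1"
    using iff(1) G unfolding NG1_block_def NG1_graph_def NG_graph_def by blast
  show "NG2_block (\<alpha>, \<beta>) \<longleftrightarrow> last \<alpha> > 1"
    using iff(2) G unfolding NG2_block_def NG2_graph_def NG_graph_def by blast
qed

section \<open>Monotonicity of the NG classes\<close>

theorem theorem4p26:
  fixes n :: nat and \<alpha>\<^sub>1 \<beta>\<^sub>1 \<alpha>\<^sub>2 \<beta>\<^sub>2 :: "nat list"
  assumes "n > 0"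
    and "(\<alpha>\<^sub>1, \<beta>\<^sub>1) \<in> S_Block n" and "unbalanced_block (\<alpha>\<^sub>1, \<beta>\<^sub>1)"
    and "(\<alpha>\<^sub>2, \<beta>\<^sub>2) \<in> S_Block n" and "unbalanced_block (\<alpha>\<^sub>2, \<beta>\<^sub>2)"
    and "block_ge (\<alpha>\<^sub>1, \<beta>\<^sub>1) (\<alpha>\<^sub>2, \<beta>\<^sub>2)"
  shows "(NG1_block (\<alpha>\<^sub>1, \<beta>\<^sub>1) \<longrightarrow> NG1_block (\<alpha>\<^sub>2, \<beta>\<^sub>2)) \<and>
         (NG2_block (\<alpha>\<^sub>1, \<beta>\<^sub>1) \<longrightarrow> NG2_block (\<alpha>\<^sub>2, \<beta>\<^sub>2))"
proof -
  have dis: "\<alpha>\<^sub>1 \<in> Dis n" "\<beta>\<^sub>1 \<in> Dis n" "\<alpha>\<^sub>2 \<in> Dis n" "\<beta>\<^sub>2 \<in> Dis n"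
    using assms(2,4) by (auto simp: S_Block_def)
  have dom: "dominates_part \<alpha>\<^sub>1 \<alpha>\<^sub>2" "dominates_part \<beta>\<^sub>2 \<beta>\<^sub>1"
    using assms(6) by (simp_all add: block_ge_def)
  have "length \<alpha>\<^sub>1 \<le> length \<alpha>\<^sub>2" "length \<beta>\<^sub>2 \<le> length \<beta>\<^sub>1"
    using dominates_part_length_le dis dom by blast+
  moreover have "length \<alpha>\<^sub>1 = length \<beta>\<^sub>1" "length \<alpha>\<^sub>2 = length \<beta>\<^sub>2"
    using unbalanced_block_length_eq assms(1-5) by blast+
  ultimately have len: "length \<alpha>\<^sub>1 = length \<alpha>\<^sub>2" "length \<beta>\<^sub>2 = length \<beta>\<^sub>1" by simp_all
  have "\<gamma> \<noteq> []" if "\<gamma> \<in> Dis n" for \<gamma>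
    using that assms(1) by (auto simp: Dis_def)
  hence ne: "\<alpha>\<^sub>2 \<noteq> []" "\<beta>\<^sub>1 \<noteq> []" "\<beta>\<^sub>2 \<noteq> []" using dis by blast+
  have le: "last \<alpha>\<^sub>1 \<le> last \<alpha>\<^sub>2" "last \<beta>\<^sub>2 \<le> last \<beta>\<^sub>1"
    using dominates_part_last_le[OF dis(3,1) dom(1) len(1)]
      dominates_part_last_le[OF dis(2,4) dom(2) len(2)] ne by blast+
  have pos: "0 < last \<beta>\<^sub>2" using dis(4) ne(3) by (simp add: Dis_def)
  show ?thesis
    unfolding NG_block_iff_last[OF assms(2,1,3)] NG_block_iff_last[OF assms(4,1,5)]
    using le pos by linarith
qed

end
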